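(* Let $1\le k\le n$ and $N\ge 1$ be integers, let $A\in\mathbb{R}^{n\times n}$ be a (symmetric positive semidefinite) sample covariance matrix, and let $\lambda\in\mathbb{R}$ satisfy $\lambda\le\lambda^k(A)$. Let $\mathrm{OPT}_{\text{convex-IP}}$ be the optimal value of the problem (Convex-IP) built from $A,k,\lambda,N$ as described in the context. Then $\mathrm{OPT}_{\text{convex-IP}}$ is an upper bound on the sparse PCA problem, i.e. $$\lambda^k(A)\ \le\ \mathrm{OPT}_{\text{convex-IP}}.$$
   Context: $\|x\|_0$ is the number of nonzero components of $x$, $[n]=\{1,\dots,n\}$, a sample covariance matrix is a matrix $A=\frac1m Y^\top Y$ with $Y\in\mathbb{R}^{m\times n}$, and the optimal value of the sparse PCA problem is $$\lambda^k(A)=\max\{x^\top A x:\ \|x\|_2=1,\ \|x\|_0\le k\}.$$ Let $A=\sum_{i=1}^n\lambda_i v_iv_i^\top$ be a spectral decomposition with $v_1,\dots,v_n$ orthonormal, and put $P=\{i\in[n]:\lambda_i>\lambda\}$. For each $i$ let $\theta_i=\max\{x^\top v_i:\|x\|_2\le1,\|x\|_0\le k\}$ (alternatively, $\theta_i=\max\{x^\top v_i:\|x\|_2\le1,\|x\|_1\le\sqrt{k}\}$; either choice is allowed). The splitting points of $[-\theta_i,\theta_i]$ are equally spaced: $\gamma_i^j=\frac{j}{N}\theta_i$ for $j=-N,\dots,N$. A vector $(\eta^{-N},\dots,\eta^{N})$ is in SOS-2 if all its entries are nonnegative and sum to $1$, at most two entries are nonzero, and if two entries are nonzero they are consecutive.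 (Convex-IP) is the problem, in real variables $x_i,y_i,g_i$ ($i\in[n]$), $\xi_i$ ($i\in P$), $\eta_i^j$ ($i\in P$, $-N\le j\le N$) and $s$, of maximizing $$\lambda+\sum_{i\in P}(\lambda_i-\lambda)\,\xi_i-s$$ subject to: (1) $g_i=x^\top v_i$ and $-\theta_i\le g_i\le\theta_i$ for all $i\in[n]$; (2) for all $i\in P$: $g_i=\sum_{j=-N}^N\gamma_i^j\eta_i^j$, $\ \xi_i=\sum_{j=-N}^N(\gamma_i^j)^2\eta_i^j$, and $(\eta_i^{-N},\dots,\eta_i^N)\in$ SOS-2; (3) $\sum_{i=1}^n x_i^2\le1$ and $\sum_{i\in P}\left(\xi_i-\frac{\theta_i^2}{4N^2}\right)+\sum_{i\in[n]\setminus P}g_i^2\le1$; (4) $\sum_{i=1}^n y_i\le\sqrt{k}$, and $y_i\ge x_i$, $y_i\ge-x_i$ for all $i\in[n]$; (5) $\sum_{i:\lambda_i<\lambda}-(\lambda_i-\lambda)g_i^2\le s$. *)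

theory Defs
  imports "HOL-Analysis.Analysis"
begin

text \<open>
  Vectors in \<open>\<real>\<^sup>n\<close> are of type \<^typ>\<open>real ^ 'n\<close> with \<open>n = CARD('n)\<close>, and the index set \<open>[n]\<close> is
  the index type \<open>'n\<close>.  Optimal values are rendered by the real \<^const>\<open>Sup\<close>.  For \<open>1 \<le> k\<close>, \<open>1 \<le> N\<close> and nonnegative \<open>\<theta>\<close> the sets of
  objective values below are nonempty and bounded above, so no unspecified value arises, and the
  suprema are attained.
\<close>

definition l0 :: "real ^ 'n \<Rightarrow> nat" where
  "l0 x = card {i. x $ i \<noteq> 0}"

definition l1 :: "real ^ 'n \<Rightarrow> real" where
  "l1 x = (\<Sum>i\<in>UNIV. \<bar>x $ i\<bar>)"

definition sample_covariance :: "real ^ 'n ^ 'm \<Rightarrow> real ^ 'n ^ 'n" where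
  "sample_covariance Y = (1 / real CARD('m)) *\<^sub>R (transpose Y ** Y)"

definition sparse_pca :: "nat \<Rightarrow> real ^ 'n ^ 'n \<Rightarrow> real" where
  "sparse_pca k A = Sup {x \<bullet> (A *v x) | x. norm x = 1 \<and> l0 x \<le> k}"

definition outer_product :: "real ^ 'n \<Rightarrow> real ^ 'n \<Rightarrow> real ^ 'n ^ 'n" where
  "outer_product u w = (\<chi> i j. u $ i * w $ j)"

definition spectral_decomposition ::
    "real ^ 'n ^ 'n \<Rightarrow> ('n \<Rightarrow> real) \<Rightarrow> ('n \<Rightarrow> real ^ 'n) \<Rightarrow> bool" where
  "spectral_decomposition A lam v \<longleftrightarrow>
     (\<forall>i j. v i \<bullet> v j = (if i = j then 1 else 0)) \<and>
     A = (\<Sum>i\<in>UNIV. lam i *\<^sub>R outer_product (v i) (v i))"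

definition theta_l0 :: "nat \<Rightarrow> real ^ 'n \<Rightarrow> real" where
  "theta_l0 k u = Sup {x \<bullet> u | x. norm x \<le> 1 \<and> l0 x \<le> k}"

definition theta_l1 :: "nat \<Rightarrow> real ^ 'n \<Rightarrow> real" where
  "theta_l1 k u = Sup {x \<bullet> u | x. norm x \<le> 1 \<and> l1 x \<le> sqrt (real k)}"

definition split_point :: "nat \<Rightarrow> real \<Rightarrow> int \<Rightarrow> real" where
  "split_point N t j = real_of_int j / real N * t"

text \<open>
  A vector \<open>(\<eta>\<^sup>-\<^sup>N, \<dots>, \<eta>\<^sup>N)\<close> is a function on \<^typ>\<open>int\<close> of which only the values on
  \<open>{-N..N}\<close> matter.
\<close>

definition sos2 :: "nat \<Rightarrow> (int \<Rightarrow> real) \<Rightarrow> bool" where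
  "sos2 N e \<longleftrightarrow>
     (\<forall>j\<in>{- int N..int N}. 0 \<le> e j) \<and>
     (\<Sum>j=- int N..int N. e j) = 1 \<and>
     card {j \<in> {- int N..int N}. e j \<noteq> 0} \<le> 2 \<and>
     (\<forall>i\<in>{- int N..int N}. \<forall>j\<in>{- int N..int N}.
        i < j \<and> e i \<noteq> 0 \<and> e j \<noteq> 0 \<longrightarrow> j = i + 1)"

definition large_idx :: "('n \<Rightarrow> real) \<Rightarrow> real \<Rightarrow> 'n set" where
  "large_idx lam l = {i. l < lam i}"

text \<open>
  The variables \<open>\<xi> i\<close> and \<open>\<eta> i j\<close> exist only for \<open>i \<in> large_idx lam l\<close>; the total functions below
  take arbitrary values elsewhere, which enter neither the constraints nor the objective.
\<close>

definition convex_ip_feasible ::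
    "nat \<Rightarrow> nat \<Rightarrow> real \<Rightarrow> ('n \<Rightarrow> real) \<Rightarrow> ('n \<Rightarrow> real ^ 'n) \<Rightarrow> ('n \<Rightarrow> real) \<Rightarrow>
     real ^ 'n \<Rightarrow> real ^ 'n \<Rightarrow> ('n \<Rightarrow> real) \<Rightarrow> ('n \<Rightarrow> real) \<Rightarrow> ('n \<Rightarrow> int \<Rightarrow> real) \<Rightarrow> real \<Rightarrow> bool" where
  "convex_ip_feasible k N l lam v \<theta> x y g \<xi> \<eta> s \<longleftrightarrow>
     (\<forall>i. g i = x \<bullet> v i \<and> - \<theta> i \<le> g i \<and> g i \<le> \<theta> i) \<and>
     (\<forall>i\<in>large_idx lam l.
        g i = (\<Sum>j=- int N..int N. split_point N (\<theta> i) j * \<eta> i j) \<and>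
        \<xi> i = (\<Sum>j=- int N..int N. (split_point N (\<theta> i) j)\<^sup>2 * \<eta> i j) \<and>
        sos2 N (\<eta> i)) \<and>
     (\<Sum>i\<in>UNIV. (x $ i)\<^sup>2) \<le> 1 \<and>
     (\<Sum>i\<in>large_idx lam l. \<xi> i - (\<theta> i)\<^sup>2 / (4 * (real N)\<^sup>2))
       + (\<Sum>i\<in>UNIV - large_idx lam l. (g i)\<^sup>2) \<le> 1 \<and>
     (\<Sum>i\<in>UNIV. y $ i) \<le> sqrt (real k) \<and>
     (\<forall>i. x $ i \<le> y $ i \<and> - (x $ i) \<le> y $ i) \<and>
     (\<Sum>i | lam i < l. - (lam i - l) * (g i)\<^sup>2) \<le> s"

definition convex_ip_objective ::
    "real \<Rightarrow> ('n::finite \<Rightarrow> real) \<Rightarrow> ('n \<Rightarrow> real) \<Rightarrow> real \<Rightarrow> real" where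
  "convex_ip_objective l lam \<xi> s = l + (\<Sum>i\<in>large_idx lam l. (lam i - l) * \<xi> i) - s"

definition convex_ip_opt ::
    "nat \<Rightarrow> nat \<Rightarrow> real \<Rightarrow> ('n \<Rightarrow> real) \<Rightarrow> ('n \<Rightarrow> real ^ 'n) \<Rightarrow> ('n \<Rightarrow> real) \<Rightarrow> real" where
  "convex_ip_opt k N l lam v \<theta> =
     Sup {convex_ip_objective l lam \<xi> s | x y g \<xi> \<eta> s.
            convex_ip_feasible k N l lam v \<theta> x y g \<xi> \<eta> s}"

end

theory Submission
  imports Defs
begin

text \<open>
  Every \<open>k\<close>-sparse unit vector \<open>x\<close> extends to a feasible point of (Convex-IP) whose objective value
  is at least \<open>x \<bullet> (A *v x)\<close>; taking suprema gives the claim.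

  Put \<open>g i = x \<bullet> v i\<close>.  By Parseval the squares of the \<open>g i\<close> sum to \<open>1\<close>, so
  \<open>x \<bullet> (A *v x) = l + (\<Sum>i. (lam i - l) * (g i)\<^sup>2)\<close>.  The indices with \<open>lam i < l\<close> contribute exactly
  \<open>- s\<close> when \<open>s\<close> equals its lower bound, and for the indices with \<open>l < lam i\<close> it suffices that
  \<open>(g i)\<^sup>2 \<le> \<xi> i\<close>.  This is what the SOS-2 constraint provides: with weight on the two splitting
  points around \<open>g i\<close>, the value \<open>\<xi> i\<close> is the piecewise linear interpolant of the square function,
  which by convexity lies above it, and overshoots by at most a quarter of the squared mesh size
  \<open>\<theta> i / N\<close> (lemma \<open>sos2_square_interpolation\<close>).  That error is the slack
  \<open>(\<theta> i)\<^sup>2 / (4 * N\<^sup>2)\<close> in the constraint on the sum of the \<open>\<xi> i\<close>, which therefore follows from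
  Parseval again.
  The bounds on \<open>g i\<close> and on the sum of the \<open>y i\<close> hold because a sparse vector of the unit ball has
  \<open>l1\<close>-norm at most \<open>sqrt k\<close>, so it is admissible for either definition of \<open>\<theta> i\<close>.

  Since the optimal value is a real supremum, the objective must also be bounded on the feasible set
  (lemma \<open>convex_ip_objective_bounded\<close>): \<open>\<xi> i\<close> is an average of numbers at most \<open>(\<theta> i)\<^sup>2\<close>, and
  \<open>s\<close> is nonnegative.
\<close>

section \<open>Sparse vectors\<close>

lemma sum_squares_eq_norm_square:
  fixes x :: "real ^ 'n"
  shows "(\<Sum>i\<in>UNIV. (x $ i)\<^sup>2) = (norm x)\<^sup>2"
  by (simp add: norm_vec_def L2_set_def sum_nonneg)

lemma l1_le_sqrt_sparsity:
  fixes x :: "real ^ 'n"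
  assumes "norm x \<le> 1" and "l0 x \<le> k"
  shows "l1 x \<le> sqrt (real k)"
proof -
  define S where "S = {i. x $ i \<noteq> 0}"
  have "l1 x = (\<Sum>i\<in>S. \<bar>x $ i\<bar>)"
    unfolding l1_def S_def by (rule sum.mono_neutral_right) auto
  then have "(l1 x)\<^sup>2 \<le> (\<Sum>i\<in>S. \<bar>x $ i\<bar>\<^sup>2) * real (card S)"
    using sum_squared_le_sum_of_squares[of "\<lambda>i. \<bar>x $ i\<bar>" S] by simp
  also have "\<dots> \<le> 1 * real k"
  proof (rule mult_mono)
    have "(\<Sum>i\<in>S. \<bar>x $ i\<bar>\<^sup>2) \<le> (\<Sum>i\<in>UNIV. \<bar>x $ i\<bar>\<^sup>2)"
      by (rule sum_mono2) auto
    also have "\<dots> = (norm x)\<^sup>2"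
      by (simp add: sum_squares_eq_norm_square)
    also have "\<dots> \<le> 1"
      using assms(1) by (simp add: power_le_one)
    finally show "(\<Sum>i\<in>S. \<bar>x $ i\<bar>\<^sup>2) \<le> 1" .
    show "real (card S) \<le> real k"
      using assms(2) by (simp add: l0_def S_def)
  qed auto
  finally show ?thesis
    by (simp add: real_le_rsqrt)
qed

lemma l0_uminus: "l0 (- x) = l0 x"
  by (simp add: l0_def)

lemma abs_inner_le_Sup_unit_ball:
  fixes u x :: "real ^ 'n"
  assumes "norm x \<le> 1" and "P x" and "P (- x)"
  shows "\<bar>x \<bullet> u\<bar> \<le> Sup {x \<bullet> u | x. norm x \<le> 1 \<and> P x}"
    (is "_ \<le> Sup ?T")
proof -
  have "z \<bullet> u \<le> norm u" if "norm z \<le> 1" for z :: "real ^ 'n"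
    using norm_cauchy_schwarz[of z u] mult_right_mono[OF that, of "norm u"] by simp
  then have bdd: "bdd_above ?T"
    by (intro bdd_aboveI[of _ "norm u"]) auto
  have "x \<bullet> u \<in> ?T"
    using assms by blast
  moreover have "(- x) \<bullet> u \<in> ?T"
    using assms by (intro CollectI exI[of _ "- x"]) auto
  ultimately have "x \<bullet> u \<le> Sup ?T" and "(- x) \<bullet> u \<le> Sup ?T"
    using bdd by (meson cSup_upper)+
  then show ?thesis
    by (simp add: abs_le_iff)
qed

lemma abs_inner_le_theta:
  fixes u x :: "real ^ 'n"
  assumes "norm x \<le> 1" and "l0 x \<le> k"
  shows "\<bar>x \<bullet> u\<bar> \<le> theta_l0 k u" and "\<bar>x \<bullet> u\<bar> \<le> theta_l1 k u"
proof -
  show "\<bar>x \<bullet> u\<bar> \<le> theta_l0 k u"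
    unfolding theta_l0_def
    using assms by (intro abs_inner_le_Sup_unit_ball) (auto simp: l0_uminus)
  show "\<bar>x \<bullet> u\<bar> \<le> theta_l1 k u"
    unfolding theta_l1_def
    using assms l1_le_sqrt_sparsity[of x k] l1_le_sqrt_sparsity[of "- x" k]
    by (intro abs_inner_le_Sup_unit_ball) (auto simp: l0_uminus)
qed

lemma exists_sparse_unit_vector:
  assumes "1 \<le> k"
  shows "\<exists>x :: real ^ 'n. norm x = 1 \<and> l0 x \<le> k"
proof -
  define i :: 'n where "i = undefined"
  have "l0 (axis i (1::real)) = card {i}"
    unfolding l0_def by (rule arg_cong[of _ _ card]) (auto simp: axis_def)
  then show ?thesis
    using assms by (intro exI[of _ "axis i 1"]) (simp add: norm_axis_1)
qed

section \<open>The quadratic form in an orthonormal eigenbasis\<close>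

lemma outer_product_mult_vec: "outer_product u w *v x = (w \<bullet> x) *\<^sub>R u"
  by (simp add: vec_eq_iff matrix_vector_mult_def outer_product_def inner_vec_def
      sum_distrib_left sum_distrib_right mult_ac)

text \<open>
  The matrix with rows \<open>v i\<close> is square, so its orthonormal rows make it orthogonal, and it maps \<open>x\<close>
  to the vector of coordinates \<open>v i \<bullet> x\<close> while preserving the norm.
\<close>

lemma orthonormal_parseval:
  fixes v :: "'n \<Rightarrow> real ^ 'n"
  assumes "\<And>i j. v i \<bullet> v j = (if i = j then 1 else 0)"
  shows "(\<Sum>i\<in>UNIV. (x \<bullet> v i)\<^sup>2) = (norm x)\<^sup>2"
proof -
  define V :: "real ^ 'n ^ 'n" where "V = (\<chi> i. v i)"
  have "V ** transpose V = mat 1"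
    using assms
    by (simp add: vec_eq_iff matrix_matrix_mult_def transpose_def V_def mat_def inner_vec_def)
  then have "transpose V ** V = mat 1"
    by (simp add: matrix_left_right_inverse)
  then have "orthogonal_transformation ((*v) V)"
    by (simp add: orthogonal_transformation_matrix orthogonal_matrix)
  then have "norm (V *v x) = norm x"
    by (rule orthogonal_transformation_norm)
  moreover have "(V *v x) $ i = x \<bullet> v i" for i
    by (simp add: V_def matrix_vector_mul_component inner_commute)
  ultimately show ?thesis
    using sum_squares_eq_norm_square[of "V *v x"] by simp
qed

lemma quadratic_form_spectral:
  fixes A :: "real ^ 'n ^ 'n"
  assumes "spectral_decomposition A lam v"
  shows "x \<bullet> (A *v x) = (\<Sum>i\<in>UNIV. lam i * (x \<bullet> v i)\<^sup>2)"
proof -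
  have "(\<Sum>i\<in>I. lam i *\<^sub>R outer_product (v i) (v i)) *v x = (\<Sum>i\<in>I. (lam i * (v i \<bullet> x)) *\<^sub>R v i)"
    if "finite I" for I
    using that
    by (induction I)
      (simp_all add: matrix_vector_mult_add_rdistrib outer_product_mult_vec
        scaleR_matrix_vector_assoc[symmetric])
  then have "A *v x = (\<Sum>i\<in>UNIV. (lam i * (v i \<bullet> x)) *\<^sub>R v i)"
    using assms by (simp add: spectral_decomposition_def)
  then show ?thesis
    by (simp add: inner_sum_right inner_commute power2_eq_square mult_ac)
qed

text \<open>
  Parseval turns the constant \<open>l\<close> into \<open>\<Sum>i. l * (x \<bullet> v i)\<^sup>2\<close>; this is where the objective of
  (Convex-IP) comes from.
\<close>

lemma quadratic_form_spectral_shifted: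
  fixes A :: "real ^ 'n ^ 'n"
  assumes "spectral_decomposition A lam v" and "norm x = 1"
  shows "x \<bullet> (A *v x) = l + (\<Sum>i\<in>large_idx lam l. (lam i - l) * (x \<bullet> v i)\<^sup>2)
           - (\<Sum>i | lam i < l. - (lam i - l) * (x \<bullet> v i)\<^sup>2)"
proof -
  let ?q = "\<lambda>i. (lam i - l) * (x \<bullet> v i)\<^sup>2"
  have "(\<Sum>i\<in>UNIV. (x \<bullet> v i)\<^sup>2) = 1"
    using assms orthonormal_parseval[of v x] by (simp add: spectral_decomposition_def)
  then have "x \<bullet> (A *v x) = l + (\<Sum>i\<in>UNIV. ?q i)"
    using quadratic_form_spectral[OF assms(1), of x]
    by (simp add: left_diff_distrib sum_subtractf flip: sum_distrib_left)
  also have "(\<Sum>i\<in>UNIV. ?q i) = (\<Sum>i\<in>large_idx lam l \<union> {i. lam i < l}. ?q i)"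
    by (rule sum.mono_neutral_right) (auto simp: large_idx_def not_less)
  also have "\<dots> = (\<Sum>i\<in>large_idx lam l. ?q i) + (\<Sum>i | lam i < l. ?q i)"
    by (rule sum.union_disjoint) (auto simp: large_idx_def)
  finally show ?thesis
    by (simp only: mult_minus_left sum_negf)
qed

section \<open>Piecewise linear interpolation of the square\<close>

text \<open>
  On a mesh of width \<open>h\<close>, the chord of the square function between consecutive mesh points exceeds
  the square at the point with barycentric weights \<open>1 - w\<close> and \<open>w\<close> by exactly
  \<open>h\<^sup>2 * w * (1 - w)\<close>, which lies between \<open>0\<close> and \<open>h\<^sup>2 / 4\<close>.
\<close>

lemma sos2_square_interpolation:
  assumes "1 \<le> N" and "\<bar>c\<bar> \<le> t"
  shows "\<exists>e. sos2 N e
    \<and> c = (\<Sum>j=- int N..int N. split_point N t j * e j)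
    \<and> c\<^sup>2 \<le> (\<Sum>j=- int N..int N. (split_point N t j)\<^sup>2 * e j)
    \<and> (\<Sum>j=- int N..int N. (split_point N t j)\<^sup>2 * e j) - t\<^sup>2 / (4 * (real N)\<^sup>2) \<le> c\<^sup>2"
proof -
  define h where "h = t / real N"
  have N: "real N > 0"
    using assms(1) by simp
  obtain r where r: "c = h * r" "\<bar>r\<bar> \<le> real N"
  proof (cases "t = 0")
    case True
    then show ?thesis
      using that[of 0] assms by simp
  next
    case False
    then have "t > 0"
      using assms(2) by linarith
    then have "\<bar>c / t\<bar> \<le> 1"
      using assms(2) by simp
    then have "\<bar>c / t * real N\<bar> \<le> real N"
      using mult_right_mono[of "\<bar>c / t\<bar>" 1 "real N"] by (simp add: abs_mult)
    then show ?thesis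
      using that[of "c / t * real N"] False N by (simp add: h_def)
  qed
  \<comment> \<open>The cap at \<open>N - 1\<close> matters for \<open>r = N\<close>, where \<open>\<lfloor>r\<rfloor> + 1\<close> would leave the mesh.\<close>
  define m where "m = min \<lfloor>r\<rfloor> (int N - 1)"
  define w where "w = r - of_int m"
  have m: "- int N \<le> m" "m + 1 \<le> int N"
    using r(2) assms(1) by (auto simp: m_def le_floor_iff)
  have w: "0 \<le> w" "w \<le> 1"
    using r(2) unfolding w_def m_def by linarith+
  define e where "e j = (if j = m then 1 - w else if j = m + 1 then w else 0)" for j
  have two_points: "(\<Sum>j=- int N..int N. f j * e j) = f m * (1 - w) + f (m + 1) * w"
    for f :: "int \<Rightarrow> real"
  proof -
    have "(\<Sum>j=- int N..int N. f j * e j) = (\<Sum>j\<in>{m, m + 1}. f j * e j)"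
      by (rule sum.mono_neutral_right) (use m in \<open>auto simp: e_def\<close>)
    then show ?thesis
      by (simp add: e_def)
  qed
  have split: "split_point N t j = h * of_int j" for j
    by (simp add: split_point_def h_def)
  have rw: "r = of_int m + w"
    by (simp add: w_def)
  have "sos2 N e"
  proof -
    have "card {j \<in> {- int N..int N}. e j \<noteq> 0} \<le> card {m, m + 1}"
      by (rule card_mono) (auto simp: e_def)
    then have "card {j \<in> {- int N..int N}. e j \<noteq> 0} \<le> 2"
      by simp
    moreover have "(\<Sum>j=- int N..int N. e j) = 1"
      using two_points[of "\<lambda>_. 1"] by simp
    ultimately show ?thesis
      using w by (auto simp: sos2_def e_def split: if_splits)
  qed
  moreover have "c = (\<Sum>j=- int N..int N. split_point N t j * e j)"
    unfolding two_points split r(1) rw by (simp add: algebra_simps)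
  moreover have chord: "(\<Sum>j=- int N..int N. (split_point N t j)\<^sup>2 * e j) = c\<^sup>2 + h\<^sup>2 * (w * (1 - w))"
    unfolding two_points split r(1) rw by (simp add: power2_eq_square algebra_simps)
  moreover have "0 \<le> h\<^sup>2 * (w * (1 - w))"
    using w by simp
  moreover have "h\<^sup>2 * (w * (1 - w)) \<le> h\<^sup>2 * (1 / 4)"
  proof (rule mult_left_mono)
    have "0 \<le> (w - 1 / 2)\<^sup>2"
      by simp
    then show "w * (1 - w) \<le> 1 / 4"
      by (simp add: power2_eq_square algebra_simps)
  qed simp
  moreover have "h\<^sup>2 * (1 / 4) = t\<^sup>2 / (4 * (real N)\<^sup>2)"
    by (simp add: h_def power_divide)
  ultimately show ?thesis
    by (intro exI[of _ e]) linarith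
qed

lemma sos2_square_le:
  assumes "1 \<le> N" and "sos2 N e"
  shows "(\<Sum>j=- int N..int N. (split_point N t j)\<^sup>2 * e j) \<le> t\<^sup>2"
proof -
  have "(split_point N t j)\<^sup>2 \<le> t\<^sup>2" if "j \<in> {- int N..int N}" for j
  proof -
    have "\<bar>real_of_int j / real N\<bar> \<le> 1"
      using that assms(1) by (auto simp: abs_le_iff)
    then have "(real_of_int j / real N)\<^sup>2 \<le> 1"
      by (simp add: abs_square_le_1)
    then show ?thesis
      unfolding split_point_def power_mult_distrib
      using mult_right_mono[of _ 1 "t\<^sup>2"] by fastforce
  qed
  then have "(\<Sum>j=- int N..int N. (split_point N t j)\<^sup>2 * e j) \<le> (\<Sum>j=- int N..int N. t\<^sup>2 * e j)"
    using assms(2) by (intro sum_mono mult_right_mono) (auto simp: sos2_def)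
  also have "\<dots> = t\<^sup>2"
    using assms(2) by (simp add: sos2_def flip: sum_distrib_left)
  finally show ?thesis .
qed

section \<open>Bounds for the integer program\<close>

lemma convex_ip_objective_bounded:
  assumes "1 \<le> N" and feas: "convex_ip_feasible k N l lam v \<theta> x y g \<xi> \<eta> s"
  shows "convex_ip_objective l lam \<xi> s \<le> l + (\<Sum>i\<in>large_idx lam l. (lam i - l) * (\<theta> i)\<^sup>2)"
proof -
  have "\<xi> i \<le> (\<theta> i)\<^sup>2" if "i \<in> large_idx lam l" for i
    using feas sos2_square_le[OF assms(1), of "\<eta> i" "\<theta> i"] that
    by (simp add: convex_ip_feasible_def)
  then have "(\<Sum>i\<in>large_idx lam l. (lam i - l) * \<xi> i)
      \<le> (\<Sum>i\<in>large_idx lam l. (lam i - l) * (\<theta> i)\<^sup>2)"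
    by (intro sum_mono mult_left_mono) (auto simp: large_idx_def)
  moreover have "0 \<le> (\<Sum>i | lam i < l. - (lam i - l) * (g i)\<^sup>2)"
    by (intro sum_nonneg mult_nonneg_nonneg) auto
  then have "0 \<le> s"
    using feas unfolding convex_ip_feasible_def by linarith
  ultimately show ?thesis
    by (simp add: convex_ip_objective_def)
qed

lemma convex_ip_objective_le_opt:
  assumes "1 \<le> N" and "convex_ip_feasible k N l lam v \<theta> x y g \<xi> \<eta> s"
  shows "convex_ip_objective l lam \<xi> s \<le> convex_ip_opt k N l lam v \<theta>"
  unfolding convex_ip_opt_def
proof (rule cSup_upper)
  show "bdd_above {convex_ip_objective l lam \<xi> s | x y g \<xi> \<eta> s.
      convex_ip_feasible k N l lam v \<theta> x y g \<xi> \<eta> s}"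
    by (rule bdd_aboveI) (use convex_ip_objective_bounded[OF assms(1)] in blast)
qed (use assms(2) in blast)

text \<open>
  The feasible point takes \<open>y i = \<bar>x i\<bar>\<close>, the interpolation weights of \<open>x \<bullet> v i\<close> for \<open>\<eta> i\<close>, and the
  smallest admissible \<open>s\<close>.
\<close>

lemma sparse_vector_extends_to_feasible:
  fixes A :: "real ^ 'n ^ 'n"
  assumes "1 \<le> N" and spec: "spectral_decomposition A lam v"
    and x: "norm x = 1" "l0 x \<le> k" and theta: "\<And>i. \<bar>x \<bullet> v i\<bar> \<le> \<theta> i"
  shows "\<exists>y g \<xi> \<eta> s. convex_ip_feasible k N l lam v \<theta> x y g \<xi> \<eta> s
           \<and> x \<bullet> (A *v x) \<le> convex_ip_objective l lam \<xi> s"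
proof -
  let ?L = "large_idx lam l"
  define g where "g i = x \<bullet> v i" for i
  define y :: "real ^ 'n" where "y = (\<chi> i. \<bar>x $ i\<bar>)"
  define s where "s = (\<Sum>i | lam i < l. - (lam i - l) * (g i)\<^sup>2)"
  have "\<forall>i. \<exists>e. sos2 N e
      \<and> g i = (\<Sum>j=- int N..int N. split_point N (\<theta> i) j * e j)
      \<and> (g i)\<^sup>2 \<le> (\<Sum>j=- int N..int N. (split_point N (\<theta> i) j)\<^sup>2 * e j)
      \<and> (\<Sum>j=- int N..int N. (split_point N (\<theta> i) j)\<^sup>2 * e j)
          - (\<theta> i)\<^sup>2 / (4 * (real N)\<^sup>2) \<le> (g i)\<^sup>2"
    unfolding g_def by (intro allI sos2_square_interpolation assms(1) theta)
  from choice[OF this] obtain \<eta> where \<eta>: "sos2 N (\<eta> i)"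
      "g i = (\<Sum>j=- int N..int N. split_point N (\<theta> i) j * \<eta> i j)"
      "(g i)\<^sup>2 \<le> (\<Sum>j=- int N..int N. (split_point N (\<theta> i) j)\<^sup>2 * \<eta> i j)"
      "(\<Sum>j=- int N..int N. (split_point N (\<theta> i) j)\<^sup>2 * \<eta> i j)
          - (\<theta> i)\<^sup>2 / (4 * (real N)\<^sup>2) \<le> (g i)\<^sup>2" for i
    by blast
  define \<xi> where "\<xi> i = (\<Sum>j=- int N..int N. (split_point N (\<theta> i) j)\<^sup>2 * \<eta> i j)" for i
  have parseval: "(\<Sum>i\<in>UNIV. (g i)\<^sup>2) = 1"
    using orthonormal_parseval[of v x] spec x(1)
    by (simp add: spectral_decomposition_def g_def)
  have "(\<Sum>i\<in>?L. \<xi> i - (\<theta> i)\<^sup>2 / (4 * (real N)\<^sup>2)) + (\<Sum>i\<in>UNIV - ?L. (g i)\<^sup>2)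
      \<le> (\<Sum>i\<in>?L. (g i)\<^sup>2) + (\<Sum>i\<in>UNIV - ?L. (g i)\<^sup>2)"
    using \<eta>(4) by (intro add_right_mono sum_mono) (simp add: \<xi>_def)
  also have "\<dots> = 1"
    using parseval sum.subset_diff[of ?L UNIV "\<lambda>i. (g i)\<^sup>2"] by simp
  finally have slack: "(\<Sum>i\<in>?L. \<xi> i - (\<theta> i)\<^sup>2 / (4 * (real N)\<^sup>2))
      + (\<Sum>i\<in>UNIV - ?L. (g i)\<^sup>2) \<le> 1" .
  have ball: "(\<Sum>i\<in>UNIV. (x $ i)\<^sup>2) \<le> 1"
    using x(1) by (simp add: sum_squares_eq_norm_square)
  have l1: "(\<Sum>i\<in>UNIV. y $ i) \<le> sqrt (real k)"
    using l1_le_sqrt_sparsity[of x k] x by (simp add: y_def l1_def)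
  have g_bounds: "- \<theta> i \<le> g i" "g i \<le> \<theta> i" for i
    using theta[of i] by (auto simp: g_def abs_le_iff)
  have y_bounds: "x $ i \<le> y $ i" "- (x $ i) \<le> y $ i" for i
    by (auto simp: y_def)
  have "convex_ip_feasible k N l lam v \<theta> x y g \<xi> \<eta> s"
    unfolding convex_ip_feasible_def
    by (intro conjI allI ballI)
      (rule g_def \<xi>_def \<eta>(1,2) slack ball l1 g_bounds y_bounds eq_refl[OF s_def[symmetric]])+
  moreover have "(\<Sum>i\<in>?L. (lam i - l) * (g i)\<^sup>2) \<le> (\<Sum>i\<in>?L. (lam i - l) * \<xi> i)"
    using \<eta>(3) by (intro sum_mono mult_left_mono) (auto simp: large_idx_def \<xi>_def)
  then have "x \<bullet> (A *v x) \<le> convex_ip_objective l lam \<xi> s"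
    using quadratic_form_spectral_shifted[OF spec x(1), of l]
    by (simp add: convex_ip_objective_def g_def s_def)
  ultimately show ?thesis
    by blast
qed

theorem proposition1:
  fixes A :: "real ^ 'n ^ 'n" and Y :: "real ^ 'n ^ 'm"
    and k N :: nat and l :: real
    and lam \<theta> :: "'n \<Rightarrow> real" and v :: "'n \<Rightarrow> real ^ 'n"
  assumes "1 \<le> k" and "k \<le> CARD('n)" and "1 \<le> N"
    and "A = sample_covariance Y"
    and "l \<le> sparse_pca k A"
    and "spectral_decomposition A lam v"
    and "\<And>i. \<theta> i = theta_l0 k (v i) \<or> \<theta> i = theta_l1 k (v i)"
  shows "sparse_pca k A \<le> convex_ip_opt k N l lam v \<theta>"
  unfolding sparse_pca_def
proof (rule cSup_least)
  show "{x \<bullet> (A *v x) | x. norm x = 1 \<and> l0 x \<le> k} \<noteq> {}"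
    using exists_sparse_unit_vector[OF assms(1)] by blast
next
  fix z
  assume "z \<in> {x \<bullet> (A *v x) | x. norm x = 1 \<and> l0 x \<le> k}"
  then obtain x where x: "norm x = 1" "l0 x \<le> k" and z: "z = x \<bullet> (A *v x)"
    by blast
  have "\<bar>x \<bullet> v i\<bar> \<le> \<theta> i" for i
    using assms(7)[of i] abs_inner_le_theta[of x k "v i"] x by auto
  from sparse_vector_extends_to_feasible[OF assms(3,6) x this]
  obtain y g \<xi> \<eta> s where feas: "convex_ip_feasible k N l lam v \<theta> x y g \<xi> \<eta> s"
    and "x \<bullet> (A *v x) \<le> convex_ip_objective l lam \<xi> s"
    by blast
  then show "z \<le> convex_ip_opt k N l lam v \<theta>"
    using convex_ip_objective_le_opt[OF assms(3) feas] z by linarith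
qed

end
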